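(* For every environment $L$ and term $T$ it is decidable whether there exists an arity $A$ such that $L\vdash T::A$.
   Context: Fix a nonempty set $\Sigma$ of sorts and a countably infinite set of variables (with decidable equality). Terms and environments are given by $T,U,V,W ::= \star s \mid x \mid \mathrm{app}(V,T) \mid \lambda x{:}W.\,T \mid \mathrm{def}(x{=}V).\,T \mid \mathrm{cast}(U,T)$ ($s\in\Sigma$, $x$ a variable) and $L,K ::= \emptyset \mid K,x{:}W \mid K,x{=}V$, where $\mathrm{app}(V,T)$ applies $T$ to $V$, $\lambda x{:}W.\,T$ is de Bruijn's abstraction binding $x$ in $T$, $\mathrm{def}(x{=}V).\,T$ is a local definition binding $x$ in $T$, $\mathrm{cast}(U,T)$ annotates $T$ with expected type $U$; environment entries $x{:}W$ (declaration) and $x{=}V$ (definition) bind $x$. Terms are taken modulo renaming of bound variables. Write $K,x[V]$ for either $K,x{:}V$ or $K,x{=}V$. Arities are $A,B::=\circ\mid B\Rightarrow A$. Arity assignment $L\vdash T::A$ is the smallest relation closed under: $L\vdash\star s::\circ$; if $K\vdash V::A$ then $K,x[V]\vdash x::A$; if $K\vdash x::A$ and $y\neq x$ then $K,y[V]\vdash x::A$; if $L\vdash W::B$ and $L,x{:}W\vdash T::A$ then $L\vdash\lambda x{:}W.\,T::B\Rightarrow A$; if $L\vdash V::B$ and $L,x{=}V\vdash T::A$ then $L\vdash\mathrm{def}(x{=}V).\,T::A$; if $L\vdash V::B$ and $L\vdash T::B\Rightarrow A$ then $L\vdash\mathrm{app}(V,T)::A$; if $L\vdash U::A$ and $L\vdash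 T::A$ then $L\vdash\mathrm{cast}(U,T)::A$. *)

theory Defs
  imports Main "HOL-Library.Nat_Bijection"
begin

section \<open>Terms modulo renaming of bound variables\<close>

text \<open>The set of sorts is the type variable \<open>'s\<close> (types are nonempty), the set of variables is
  \<open>'v\<close>.  The set function \<open>occurring\<close> collects all variables: free, bound and binding.\<close>

datatype (dead 's, occurring: 'v) preterm =
    PSort 's
  | PVar 'v
  | PApp "('s, 'v) preterm" "('s, 'v) preterm"
  | PLam 'v "('s, 'v) preterm" "('s, 'v) preterm"
  | PDef 'v "('s, 'v) preterm" "('s, 'v) preterm"
  | PCast "('s, 'v) preterm" "('s, 'v) preterm"

text \<open>\<open>rename x y T\<close> replaces the free occurrences of \<open>x\<close> by \<open>y\<close>; it is only used when \<open>y\<close> does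
  not occur in \<open>T\<close> at all, so that nothing is captured.\<close>

primrec rename :: "'v \<Rightarrow> 'v \<Rightarrow> ('s, 'v) preterm \<Rightarrow> ('s, 'v) preterm" where
  "rename x y (PSort s) = PSort s"
| "rename x y (PVar z) = PVar (if z = x then y else z)"
| "rename x y (PApp V T) = PApp (rename x y V) (rename x y T)"
| "rename x y (PLam z W T) = PLam z (rename x y W) (if z = x then T else rename x y T)"
| "rename x y (PDef z V T) = PDef z (rename x y V) (if z = x then T else rename x y T)"
| "rename x y (PCast U T) = PCast (rename x y U) (rename x y T)"

text \<open>The least congruence containing the renamings of a bound variable to a new one.\<close>

inductive alpha :: "('s, 'v) preterm \<Rightarrow> ('s, 'v) preterm \<Rightarrow> bool" where
  alpha_refl: "alpha T T"
| alpha_sym: "alpha T U \<Longrightarrow> alpha U T"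
| alpha_trans: "alpha T U \<Longrightarrow> alpha U V \<Longrightarrow> alpha T V"
| alpha_App: "alpha V V' \<Longrightarrow> alpha T T' \<Longrightarrow> alpha (PApp V T) (PApp V' T')"
| alpha_Lam: "alpha W W' \<Longrightarrow> alpha T T' \<Longrightarrow> alpha (PLam x W T) (PLam x W' T')"
| alpha_Def: "alpha V V' \<Longrightarrow> alpha T T' \<Longrightarrow> alpha (PDef x V T) (PDef x V' T')"
| alpha_Cast: "alpha U U' \<Longrightarrow> alpha T T' \<Longrightarrow> alpha (PCast U T) (PCast U' T')"
| alpha_rename_Lam: "y \<notin> occurring T \<Longrightarrow> alpha (PLam x W T) (PLam y W (rename x y T))"
| alpha_rename_Def: "y \<notin> occurring T \<Longrightarrow> alpha (PDef x V T) (PDef y V (rename x y T))"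

lemma equivp_alpha: "equivp alpha"
  by (rule equivpI)
    (auto simp: reflp_def symp_def transp_def intro: alpha_refl alpha_sym alpha_trans)

quotient_type ('s, 'v) "term" = "('s, 'v) preterm" / alpha
  by (rule equivp_alpha)

lift_definition Sort :: "'s \<Rightarrow> ('s, 'v) term" is PSort .

lift_definition Var :: "'v \<Rightarrow> ('s, 'v) term" is PVar .

lift_definition App :: "('s, 'v) term \<Rightarrow> ('s, 'v) term \<Rightarrow> ('s, 'v) term" is PApp
  by (rule alpha_App)

lift_definition Lam :: "'v \<Rightarrow> ('s, 'v) term \<Rightarrow> ('s, 'v) term \<Rightarrow> ('s, 'v) term" is PLam
  by (rule alpha_Lam)

lift_definition Def :: "'v \<Rightarrow> ('s, 'v) term \<Rightarrow> ('s, 'v) term \<Rightarrow> ('s, 'v) term" is PDef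
  by (rule alpha_Def)

lift_definition Cast :: "('s, 'v) term \<Rightarrow> ('s, 'v) term \<Rightarrow> ('s, 'v) term" is PCast
  by (rule alpha_Cast)


section \<open>Environments and arity assignment\<close>

text \<open>The rightmost entry of an environment is the outermost constructor: \<open>EDecl K x W\<close> is
  \<open>K, x : W\<close> and \<open>EDef K x V\<close> is \<open>K, x = V\<close>.  Shadowing is allowed.\<close>

datatype ('s, 'v) env =
    Empty
  | EDecl "('s, 'v) env" 'v "('s, 'v) term"
  | EDef "('s, 'v) env" 'v "('s, 'v) term"

datatype arity =
    Base
  | Arrow arity arity (infixr "\<Rrightarrow>" 60)

inductive has_arity :: "('s, 'v) env \<Rightarrow> ('s, 'v) term \<Rightarrow> arity \<Rightarrow> bool" where
  has_arity_Sort: "has_arity L (Sort s) Base"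
| has_arity_Decl_hit: "has_arity K V A \<Longrightarrow> has_arity (EDecl K x V) (Var x) A"
| has_arity_Def_hit: "has_arity K V A \<Longrightarrow> has_arity (EDef K x V) (Var x) A"
| has_arity_Decl_skip:
    "has_arity K (Var x) A \<Longrightarrow> y \<noteq> x \<Longrightarrow> has_arity (EDecl K y V) (Var x) A"
| has_arity_Def_skip:
    "has_arity K (Var x) A \<Longrightarrow> y \<noteq> x \<Longrightarrow> has_arity (EDef K y V) (Var x) A"
| has_arity_Lam:
    "has_arity L W B \<Longrightarrow> has_arity (EDecl L x W) T A \<Longrightarrow> has_arity L (Lam x W T) (B \<Rrightarrow> A)"
| has_arity_Def:
    "has_arity L V B \<Longrightarrow> has_arity (EDef L x V) T A \<Longrightarrow> has_arity L (Def x V T) A"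
| has_arity_App:
    "has_arity L V B \<Longrightarrow> has_arity L T (B \<Rrightarrow> A) \<Longrightarrow> has_arity L (App V T) A"
| has_arity_Cast:
    "has_arity L U A \<Longrightarrow> has_arity L T A \<Longrightarrow> has_arity L (Cast U T) A"


section \<open>Decidability\<close>

text \<open>In classical logic \<open>P \<or> \<not> P\<close> says nothing, so decidability means: some general recursive
  function computes the truth value from codes of the arguments.\<close>

text \<open>The total functions generated from zero, successor and projections by composition, primitive
  recursion and minimization of regular functions.  Only the values of an \<open>n\<close>-ary function on
  lists of length \<open>n\<close> matter.\<close>

inductive recursive :: "nat \<Rightarrow> (nat list \<Rightarrow> nat) \<Rightarrow> bool" where
  recursive_zero: "recursive n (\<lambda>xs. 0)"
| recursive_Suc: "recursive 1 (\<lambda>xs. Suc (xs ! 0))"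
| recursive_proj: "i < n \<Longrightarrow> recursive n (\<lambda>xs. xs ! i)"
| recursive_comp:
    "recursive (length gs) f \<Longrightarrow> (\<And>g. g \<in> set gs \<Longrightarrow> recursive n g) \<Longrightarrow>
     recursive n (\<lambda>xs. f (map (\<lambda>g. g xs) gs))"
| recursive_primrec:
    "recursive n f \<Longrightarrow> recursive (Suc (Suc n)) g \<Longrightarrow>
     recursive (Suc n) (\<lambda>xs. rec_nat (f (tl xs)) (\<lambda>m r. g (m # r # tl xs)) (hd xs))"
| recursive_mu:
    "recursive (Suc n) f \<Longrightarrow> (\<And>xs. length xs = n \<Longrightarrow> \<exists>m. f (m # xs) = 0) \<Longrightarrow>
     recursive n (\<lambda>xs. LEAST m. f (m # xs) = 0)"

text \<open>\<open>codes1 m a\<close> means that \<open>m\<close> is a code of \<open>a\<close>; an object may have several codes (a term has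
  one for each of its representatives).\<close>

definition decidable2 ::
    "(nat \<Rightarrow> 'a \<Rightarrow> bool) \<Rightarrow> (nat \<Rightarrow> 'b \<Rightarrow> bool) \<Rightarrow> ('a \<Rightarrow> 'b \<Rightarrow> bool) \<Rightarrow> bool" where
  "decidable2 codes1 codes2 P \<longleftrightarrow>
     (\<exists>f. recursive 2 f \<and>
       (\<forall>a b m n. codes1 m a \<longrightarrow> codes2 n b \<longrightarrow> f [m, n] = (if P a b then 1 else 0)))"

text \<open>Syntax trees are coded from numberings of the sorts and of the variables.\<close>

primrec preterm_code :: "('s \<Rightarrow> nat) \<Rightarrow> ('v \<Rightarrow> nat) \<Rightarrow> ('s, 'v) preterm \<Rightarrow> nat" where
  "preterm_code cs cv (PSort s) = list_encode [0, cs s]"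
| "preterm_code cs cv (PVar x) = list_encode [1, cv x]"
| "preterm_code cs cv (PApp V T) =
     list_encode [2, preterm_code cs cv V, preterm_code cs cv T]"
| "preterm_code cs cv (PLam x W T) =
     list_encode [3, cv x, preterm_code cs cv W, preterm_code cs cv T]"
| "preterm_code cs cv (PDef x V T) =
     list_encode [4, cv x, preterm_code cs cv V, preterm_code cs cv T]"
| "preterm_code cs cv (PCast U T) =
     list_encode [5, preterm_code cs cv U, preterm_code cs cv T]"

definition codes_term :: "('s \<Rightarrow> nat) \<Rightarrow> ('v \<Rightarrow> nat) \<Rightarrow> nat \<Rightarrow> ('s, 'v) term \<Rightarrow> bool" where
  "codes_term cs cv n T \<longleftrightarrow> (\<exists>t. T = abs_term t \<and> n = preterm_code cs cv t)"

inductive codes_env :: "('s \<Rightarrow> nat) \<Rightarrow> ('v \<Rightarrow> nat) \<Rightarrow> nat \<Rightarrow> ('s, 'v) env \<Rightarrow> bool"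
  for cs :: "'s \<Rightarrow> nat" and cv :: "'v \<Rightarrow> nat" where
  codes_Empty: "codes_env cs cv (list_encode [0]) Empty"
| codes_EDecl:
    "codes_env cs cv m K \<Longrightarrow> codes_term cs cv n W \<Longrightarrow>
     codes_env cs cv (list_encode [1, m, cv x, n]) (EDecl K x W)"
| codes_EDef:
    "codes_env cs cv m K \<Longrightarrow> codes_term cs cv n V \<Longrightarrow>
     codes_env cs cv (list_encode [2, m, cv x, n]) (EDef K x V)"

end

theory Submission
  imports Defs
begin

text \<open>The arity of a term depends on the environment only through the arities of the variables, so
  replacing arities by numbers (\<open>0\<close> for ``none'') turns the rules into an evaluator.  It respects
  renaming of bound variables, and on representatives it can be followed on codes: the environment is
  itself a code, which grows at binders and shrinks at variables.  Because of these changes the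
  recursion is not a primitive recursion on one argument; the evaluator is therefore run by a stack
  machine whose step function is recursive, and minimization finds its halting time.\<close>

section \<open>Closure properties of recursive functions\<close>

text \<open>\<open>recursive\<close> fixes a function on lists of every length. Agreement on lists
  of length \<open>n\<close> alone makes the notion stable under rewriting the function, as in
  \<open>computable_cong\<close>.\<close>

definition computable :: "nat \<Rightarrow> (nat list \<Rightarrow> nat) \<Rightarrow> bool" where
  "computable n f \<longleftrightarrow> (\<exists>g. recursive n g \<and> (\<forall>xs. length xs = n \<longrightarrow> f xs = g xs))"

lemma computable_cong:
  assumes "computable n f" and "\<And>xs. length xs = n \<Longrightarrow> f xs = g xs"
  shows "computable n g"
  using assms unfolding computable_def by metis

lemma computable_proj: "i < n \<Longrightarrow> computable n (\<lambda>xs. xs ! i)"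
  unfolding computable_def using recursive_proj by blast

lemma computable_comp:
  assumes f: "computable (length gs) f" and gs: "\<And>g. g \<in> set gs \<Longrightarrow> computable n g"
  shows "computable n (\<lambda>xs. f (map (\<lambda>g. g xs) gs))"
proof -
  obtain f' where f': "recursive (length gs) f'" "\<And>xs. length xs = length gs \<Longrightarrow> f xs = f' xs"
    using f unfolding computable_def by blast
  have "\<forall>g\<in>set gs. \<exists>g'. recursive n g' \<and> (\<forall>xs. length xs = n \<longrightarrow> g xs = g' xs)"
    using gs unfolding computable_def by blast
  then obtain h where h: "\<And>g. g \<in> set gs \<Longrightarrow> recursive n (h g)"
      "\<And>g xs. g \<in> set gs \<Longrightarrow> length xs = n \<Longrightarrow> g xs = h g xs"
    by metis
  have "recursive n (\<lambda>xs. f' (map (\<lambda>g. g xs) (map h gs)))"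
    using f'(1) h(1) by (intro recursive_comp) auto
  moreover have "f (map (\<lambda>g. g xs) gs) = f' (map (\<lambda>g. g xs) (map h gs))" if "length xs = n" for xs
    using f'(2)[of "map (\<lambda>g. g xs) gs"] h(2) that by (auto simp: comp_def cong: map_cong)
  ultimately show ?thesis
    unfolding computable_def by blast
qed

lemma computable_comp1:
  assumes "computable 1 (\<lambda>xs. F (xs ! 0))" and "computable n f"
  shows "computable n (\<lambda>xs. F (f xs))"
  using computable_comp[of "[f]" "\<lambda>xs. F (xs ! 0)" n] assms by simp

lemma computable_comp2:
  assumes "computable 2 (\<lambda>xs. F (xs ! 0) (xs ! 1))" and "computable n f" "computable n g"
  shows "computable n (\<lambda>xs. F (f xs) (g xs))"
  using computable_comp[of "[f, g]" "\<lambda>xs. F (xs ! 0) (xs ! 1)" n] assms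
  by (auto simp: numeral_2_eq_2)

lemma computable_comp3:
  assumes "computable 3 (\<lambda>xs. F (xs ! 0) (xs ! 1) (xs ! 2))"
    and "computable n f" "computable n g" "computable n h"
  shows "computable n (\<lambda>xs. F (f xs) (g xs) (h xs))"
  using computable_comp[of "[f, g, h]" "\<lambda>xs. F (xs ! 0) (xs ! 1) (xs ! 2)" n] assms
  by (auto simp: numeral_2_eq_2 numeral_3_eq_3)

lemma computable_primrec:
  assumes "computable n f" and "computable (Suc (Suc n)) g"
  shows "computable (Suc n) (\<lambda>xs. rec_nat (f (tl xs)) (\<lambda>m r. g (m # r # tl xs)) (xs ! 0))"
proof -
  obtain f' where f': "recursive n f'" "\<And>xs. length xs = n \<Longrightarrow> f xs = f' xs"
    using assms(1) unfolding computable_def by blast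
  obtain g' where g': "recursive (Suc (Suc n)) g'"
      "\<And>xs. length xs = Suc (Suc n) \<Longrightarrow> g xs = g' xs"
    using assms(2) unfolding computable_def by blast
  have "rec_nat (f (tl xs)) (\<lambda>m r. g (m # r # tl xs)) (xs ! 0)
      = rec_nat (f' (tl xs)) (\<lambda>m r. g' (m # r # tl xs)) (hd xs)" if "length xs = Suc n" for xs
    using that f'(2) g'(2) by (auto simp: length_Suc_conv)
  then show ?thesis
    unfolding computable_def using recursive_primrec[OF f'(1) g'(1)] by blast
qed

lemma computable_Least:
  assumes "computable (Suc n) (\<lambda>xs. f (hd xs) (tl xs))"
    and "\<And>xs. length xs = n \<Longrightarrow> \<exists>m. f m xs = 0"
  shows "computable n (\<lambda>xs. LEAST m. f m xs = 0)"
proof -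
  obtain f' where f': "recursive (Suc n) f'"
      "\<And>xs. length xs = Suc n \<Longrightarrow> f (hd xs) (tl xs) = f' xs"
    using assms(1) unfolding computable_def by blast
  have eq: "f m xs = f' (m # xs)" if "length xs = n" for m xs
    using f'(2)[of "m # xs"] that by simp
  have "recursive n (\<lambda>xs. LEAST m. f' (m # xs) = 0)"
    using assms(2) eq by (intro recursive_mu[OF f'(1)]) force
  then show ?thesis
    unfolding computable_def using eq by force
qed

section \<open>Arithmetic, case distinction and Boolean operations\<close>

named_theorems computable

lemma computable_nth_0 [computable]: "computable 1 (\<lambda>xs. xs ! 0)"
  by (simp add: computable_proj)

lemma computable_Suc [computable]:
  assumes "computable n f"
  shows "computable n (\<lambda>xs. Suc (f xs))"
  by (rule computable_comp1[OF _ assms]) (use recursive_Suc computable_def in blast)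

lemma computable_const [computable]: "computable n (\<lambda>xs. c)"
proof (induction c)
  case 0
  then show ?case unfolding computable_def using recursive_zero by blast
qed (rule computable_Suc)

text \<open>Iteration is primitive recursion whose step ignores the counter. Addition, truncated
  subtraction, access to list items and the run of the machine are instances.\<close>

lemma computable_funpow [computable]:
  assumes F: "computable 1 (\<lambda>xs. F (xs ! 0))" and "computable n f" "computable n g"
  shows "computable n (\<lambda>xs. (F ^^ f xs) (g xs))"
proof (rule computable_comp2[OF _ assms(2,3)])
  have "computable 3 (\<lambda>xs. F (xs ! 1))"
    by (rule computable_comp1[OF F]) (simp add: computable_proj)
  then have "computable 2 (\<lambda>xs. rec_nat (tl xs ! 0) (\<lambda>m r. F ((m # r # tl xs) ! 1)) (xs ! 0))"
    using computable_primrec[of 1 "\<lambda>xs. xs ! 0" "\<lambda>xs. F (xs ! 1)"] computable_proj[of 0 1]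
    by (simp add: numeral_2_eq_2 numeral_3_eq_3)
  then show "computable 2 (\<lambda>xs. (F ^^ (xs ! 0)) (xs ! 1))"
  proof (rule computable_cong)
    fix xs :: "nat list"
    assume "length xs = 2"
    then obtain a b where "xs = [a, b]"
      by (auto simp: length_Suc_conv numeral_2_eq_2)
    moreover have "rec_nat b (\<lambda>m r. F r) k = (F ^^ k) b" for k
      by (induction k) auto
    ultimately show "rec_nat (tl xs ! 0) (\<lambda>m r. F ((m # r # tl xs) ! 1)) (xs ! 0)
        = (F ^^ (xs ! 0)) (xs ! 1)" by simp
  qed
qed

lemma computable_add [computable]:
  assumes "computable n f" "computable n g"
  shows "computable n (\<lambda>xs. f xs + g xs)"
proof -
  have "(Suc ^^ a) b = a + b" for a b
    by (induction a) auto
  moreover have "computable n (\<lambda>xs. (Suc ^^ f xs) (g xs))"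
    by (intro computable assms)
  ultimately show ?thesis by simp
qed

lemma computable_diff [computable]:
  assumes "computable n f" "computable n g"
  shows "computable n (\<lambda>xs. f xs - g xs)"
proof -
  \<comment> \<open>The predecessor is the recursion whose step returns the counter.\<close>
  have "rec_nat 0 (\<lambda>m r. m) k = k - 1" for k :: nat
    by (cases k) auto
  then have "computable 1 (\<lambda>xs. xs ! 0 - 1)"
    using computable_primrec[of 0 "\<lambda>_. 0" "\<lambda>xs. xs ! 0"]
    by (simp add: computable_const computable_proj)
  then have "computable n (\<lambda>xs. ((\<lambda>a. a - 1) ^^ g xs) (f xs))"
    by (intro computable assms)
  moreover have "((\<lambda>a. a - 1) ^^ k) b = b - k" for k b :: nat
    by (induction k) auto
  ultimately show ?thesis by simp
qed

lemma computable_eq [computable]: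
  assumes "computable n f" "computable n g"
  shows "computable n (\<lambda>xs. of_bool (f xs = g xs))"
proof -
  \<comment> \<open>Both truncated differences vanish exactly when the arguments are equal.\<close>
  have "computable n (\<lambda>xs. 1 - ((f xs - g xs) + (g xs - f xs)))"
    by (intro computable assms)
  then show ?thesis
    by (rule computable_cong) auto
qed

lemma computable_if [computable]:
  assumes "computable n (\<lambda>xs. of_bool (P xs))" "computable n f" "computable n g"
  shows "computable n (\<lambda>xs. if P xs then f xs else g xs)"
proof -
  \<comment> \<open>Recursion on the truth value: the base is the else branch, and each step returns
    the then branch regardless of the previous result.\<close>
  have "computable 3 (\<lambda>xs. rec_nat (tl xs ! 1) (\<lambda>m r. (m # r # tl xs) ! 2) (xs ! 0))"
    using computable_primrec[of 2 "\<lambda>xs. xs ! 1" "\<lambda>xs. xs ! 2"]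
    by (simp add: computable_proj numeral_2_eq_2 numeral_3_eq_3)
  then have "computable 3 (\<lambda>xs. if xs ! 0 = 0 then xs ! 2 else xs ! 1)"
  proof (rule computable_cong)
    fix xs :: "nat list"
    assume "length xs = 3"
    then obtain a b c where "xs = [a, b, c]"
      by (auto simp: length_Suc_conv numeral_3_eq_3)
    then show "rec_nat (tl xs ! 1) (\<lambda>m r. (m # r # tl xs) ! 2) (xs ! 0)
        = (if xs ! 0 = 0 then xs ! 2 else xs ! 1)"
      by (cases a) auto
  qed
  then have "computable n (\<lambda>xs. if (of_bool (P xs) :: nat) = 0 then g xs else f xs)"
    using computable_comp3[of "\<lambda>c a b. if c = 0 then b else a", OF _ assms] by blast
  then show ?thesis
    by (rule computable_cong) auto
qed

lemma computable_not [computable]: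
  assumes "computable n (\<lambda>xs. of_bool (P xs))"
  shows "computable n (\<lambda>xs. of_bool (\<not> P xs))"
proof -
  have "computable n (\<lambda>xs. if P xs then 0 else 1)"
    by (intro computable assms)
  then show ?thesis by (rule computable_cong) auto
qed

lemma computable_disj [computable]:
  assumes "computable n (\<lambda>xs. of_bool (P xs))" "computable n (\<lambda>xs. of_bool (Q xs))"
  shows "computable n (\<lambda>xs. of_bool (P xs \<or> Q xs))"
proof -
  have "computable n (\<lambda>xs. if P xs then 1 else of_bool (Q xs))"
    by (intro computable assms)
  then show ?thesis by (rule computable_cong) auto
qed

section \<open>The Cantor pairing function and its inverse\<close>

lemma computable_triangle [computable]:
  assumes "computable n f"
  shows "computable n (\<lambda>xs. triangle (f xs))"
proof (rule computable_comp1[OF _ assms])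
  have "computable 2 (\<lambda>xs. Suc (xs ! 0 + xs ! 1))"
    by (intro computable) (simp_all add: computable_proj)
  moreover have "rec_nat 0 (\<lambda>m r. Suc (m + r)) k = triangle k" for k
    by (induction k) auto
  ultimately show "computable 1 (\<lambda>xs. triangle (xs ! 0))"
    using computable_primrec[of 0 "\<lambda>_. 0" "\<lambda>xs. Suc (xs ! 0 + xs ! 1)"]
    by (simp add: computable_const numeral_2_eq_2)
qed

lemma computable_prod_encode [computable]:
  assumes "computable n f" "computable n g"
  shows "computable n (\<lambda>xs. prod_encode (f xs, g xs))"
  unfolding prod_encode_def prod.case by (intro computable assms)

text \<open>Since \<open>prod_encode (a, b) = triangle (a + b) + a\<close>, the code lies from
  \<open>triangle (a + b)\<close> up to but below \<open>triangle (Suc (a + b))\<close>, so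
  minimization finds the diagonal. The leading \<open>Suc\<close> turns truncated subtraction into a
  test for strict inequality.\<close>

lemma Least_triangle: "(LEAST k. Suc (prod_encode (a, b)) - triangle (Suc k) = 0) = a + b"
proof (rule Least_equality)
  show "Suc (prod_encode (a, b)) - triangle (Suc (a + b)) = 0"
    by (simp add: prod_encode_def)
next
  fix k
  assume k: "Suc (prod_encode (a, b)) - triangle (Suc k) = 0"
  have "triangle m \<le> triangle n" if "m \<le> n" for m n
    using that by (rule lift_Suc_mono_le[rotated]) simp
  then have "triangle (Suc k) \<le> triangle (a + b)" if "k < a + b"
    using that Suc_leI by blast
  with k show "a + b \<le> k"
    by (cases "k < a + b") (simp_all add: prod_encode_def del: triangle_Suc)
qed

lemma computable_prod_decode:
  assumes "computable n f"
  shows computable_fst [computable]: "computable n (\<lambda>xs. fst (prod_decode (f xs)))"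
    and computable_snd [computable]: "computable n (\<lambda>xs. snd (prod_decode (f xs)))"
proof -
  let ?k = "\<lambda>x. LEAST k. Suc x - triangle (Suc k) = 0"
  have "computable (Suc 1) (\<lambda>xs. Suc (xs ! 1) - triangle (Suc (xs ! 0)))"
    unfolding One_nat_def[symmetric] by (intro computable) (simp_all add: computable_proj)
  then have "computable (Suc 1) (\<lambda>xs. Suc (tl xs ! 0) - triangle (Suc (hd xs)))"
    by (rule computable_cong) (auto simp: length_Suc_conv)
  then have "computable 1 (\<lambda>xs. ?k (xs ! 0))"
  proof (rule computable_Least)
    show "\<exists>k. Suc (xs ! 0) - triangle (Suc k) = 0" for xs
      by (rule exI[of _ "xs ! 0"]) simp
  qed
  note k [computable] = computable_comp1[OF this]
  \<comment> \<open>Once the diagonal is known, the offset on it is the first component, and what is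
    missing to the number of the diagonal is the second.\<close>
  have fst: "fst (prod_decode x) = x - triangle (?k x)"
    and snd: "snd (prod_decode x) = ?k x - (x - triangle (?k x))" for x
  proof -
    obtain a b where "x = prod_encode (a, b)"
      by (metis prod_decode_inverse surj_pair)
    then show "fst (prod_decode x) = x - triangle (?k x)"
      and "snd (prod_decode x) = ?k x - (x - triangle (?k x))"
      by (simp_all only: Least_triangle prod_encode_inverse fst_conv snd_conv)
        (simp_all add: prod_encode_def)
  qed
  show "computable n (\<lambda>xs. fst (prod_decode (f xs)))"
    and "computable n (\<lambda>xs. snd (prod_decode (f xs)))"
    unfolding fst snd by (intro computable assms)+
qed


section \<open>Arities as numbers\<close>

primrec arity_code :: "arity \<Rightarrow> nat" where
  "arity_code Base = 0"
| "arity_code (B \<Rrightarrow> A) = Suc (prod_encode (arity_code B, arity_code A))"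

lemma inj_arity_code: "arity_code A = arity_code B \<Longrightarrow> A = B"
proof (induction A arbitrary: B)
  case Base
  then show ?case by (cases B) auto
next
  case (Arrow A1 A2)
  then show ?case by (cases B) auto
qed

text \<open>The components of a pair do not exceed its code, and the extra \<open>Suc\<close> makes
  them smaller than \<open>n\<close>. Thus every nonzero value denotes an arity, and having an arity
  becomes having a nonzero value.\<close>

lemma surj_arity_code: "\<exists>A. n = arity_code A"
proof (induction n rule: less_induct)
  case (less n)
  show ?case
  proof (cases n)
    case 0
    then show ?thesis by (metis arity_code.simps(1))
  next
    case (Suc m)
    obtain b a where m: "m = prod_encode (b, a)"
      by (metis prod_decode_inverse surj_pair)
    then have "b < n" "a < n"
      using Suc le_prod_encode_1[of b a] le_prod_encode_2[of a b] by auto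
    then show ?thesis
      using less Suc m by (metis arity_code.simps(2))
  qed
qed

text \<open>A value is \<open>0\<close> for ``no arity'' or \<open>Suc (arity_code A)\<close>.  The first argument of \<open>combine\<close>
  is the tag of a compound term in \<open>preterm_code\<close>.\<close>

definition combine :: "nat \<Rightarrow> nat \<Rightarrow> nat \<Rightarrow> nat" where
  "combine k b a =
    (if b = 0 \<or> a = 0 then 0
     else if k = 3 then Suc (Suc (prod_encode (b - 1, a - 1)))
     else if k = 4 then a
     else if k = 5 then (if b = a then a else 0)
     else if a = 1 \<or> fst (prod_decode (a - 2)) \<noteq> b - 1 then 0
     else Suc (snd (prod_decode (a - 2))))"

lemma computable_combine [computable]:
  assumes "computable n f" "computable n g" "computable n h"
  shows "computable n (\<lambda>xs. combine (f xs) (g xs) (h xs))"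
  unfolding combine_def by (intro computable assms)

lemma combine_Lam_eq:
  "combine 3 b a = Suc c \<longleftrightarrow>
    (\<exists>B A. b = Suc (arity_code B) \<and> a = Suc (arity_code A) \<and> c = arity_code (B \<Rrightarrow> A))"
  using surj_arity_code[of "b - 1"] surj_arity_code[of "a - 1"]
  by (cases b; cases a) (auto simp: combine_def)

lemma combine_Def_eq:
  "combine 4 b a = Suc c \<longleftrightarrow> (\<exists>B. b = Suc (arity_code B) \<and> a = Suc c)"
  using surj_arity_code[of "b - 1"] by (cases b; cases a) (auto simp: combine_def)

lemma combine_Cast_eq: "combine 5 b a = Suc c \<longleftrightarrow> b = Suc c \<and> a = Suc c"
  by (cases b; cases a) (auto simp: combine_def)

text \<open>The value of an arrow carries two successors, one for "some arity" and one for "arrow".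
  Hence \<open>a - 2\<close> is the pair of domain and codomain, and \<open>a = 1\<close> is the
  base arity, which cannot be applied.\<close>

lemma combine_App_eq:
  "combine 2 b a = Suc (arity_code A) \<longleftrightarrow>
    (\<exists>B. b = Suc (arity_code B) \<and> a = Suc (arity_code (B \<Rrightarrow> A)))"
proof
  assume eq: "combine 2 b a = Suc (arity_code A)"
  then have "b \<noteq> 0" "a \<noteq> 0" "a \<noteq> 1"
    by (auto simp: combine_def split: if_splits)
  then obtain b' a' where ba: "b = Suc b'" "a = Suc (Suc a')"
    by (metis One_nat_def not0_implies_Suc)
  obtain B where B: "b' = arity_code B"
    using surj_arity_code by blast
  have "prod_decode a' = (b', arity_code A)"
    using eq ba by (auto simp: combine_def split: if_splits intro: prod_eqI)
  then have "a' = prod_encode (b', arity_code A)"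
    by (metis prod_decode_inverse)
  then show "\<exists>B. b = Suc (arity_code B) \<and> a = Suc (arity_code (B \<Rrightarrow> A))"
    using ba B by auto
qed (auto simp: combine_def)

section \<open>Values of terms modulo renaming\<close>

primrec preterm_value :: "('v \<Rightarrow> nat) \<Rightarrow> ('s, 'v) preterm \<Rightarrow> nat" where
  "preterm_value \<rho> (PSort s) = 1"
| "preterm_value \<rho> (PVar x) = \<rho> x"
| "preterm_value \<rho> (PApp V T) = combine 2 (preterm_value \<rho> V) (preterm_value \<rho> T)"
| "preterm_value \<rho> (PLam x W T) =
     combine 3 (preterm_value \<rho> W) (preterm_value (\<rho>(x := preterm_value \<rho> W)) T)"
| "preterm_value \<rho> (PDef x V T) =
     combine 4 (preterm_value \<rho> V) (preterm_value (\<rho>(x := preterm_value \<rho> V)) T)"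
| "preterm_value \<rho> (PCast U T) = combine 5 (preterm_value \<rho> U) (preterm_value \<rho> T)"

lemma preterm_value_not_occurring:
  "y \<notin> occurring T \<Longrightarrow> preterm_value (\<rho>(y := a)) T = preterm_value \<rho> T"
  by (induction T arbitrary: \<rho>) (simp_all add: fun_upd_twist[of y])

lemma preterm_value_rename:
  "y \<notin> occurring T \<Longrightarrow> preterm_value \<rho> (rename x y T) = preterm_value (\<rho>(x := \<rho> y)) T"
  by (induction T arbitrary: \<rho>) (auto simp: fun_upd_twist)

text \<open>Occurrences of \<open>y\<close> in the renamed body come only from free occurrences of
  \<open>x\<close>, so binding \<open>y\<close> there acts as binding \<open>x\<close> before. This
  settles the two renaming rules of \<open>alpha\<close>.\<close>

lemma preterm_value_rename_bound:
  "y \<notin> occurring T \<Longrightarrow>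
    preterm_value (\<rho>(y := a)) (rename x y T) = preterm_value (\<rho>(x := a)) T"
  by (cases "x = y")
    (simp_all add: preterm_value_rename preterm_value_not_occurring fun_upd_twist[of y x])

lift_definition term_value :: "('v \<Rightarrow> nat) \<Rightarrow> ('s, 'v) term \<Rightarrow> nat" is preterm_value
proof -
  fix \<rho> and T U :: "('s, 'v) preterm"
  assume "alpha T U"
  then show "preterm_value \<rho> T = preterm_value \<rho> U"
    by (induction arbitrary: \<rho>) (simp_all add: preterm_value_rename_bound)
qed

lemma term_value_simps [simp]:
  "term_value \<rho> (Sort s) = 1"
  "term_value \<rho> (Var x) = \<rho> x"
  "term_value \<rho> (App V T) = combine 2 (term_value \<rho> V) (term_value \<rho> T)"
  "term_value \<rho> (Lam x W T) =
     combine 3 (term_value \<rho> W) (term_value (\<rho>(x := term_value \<rho> W)) T)"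
  "term_value \<rho> (Def x V T) =
     combine 4 (term_value \<rho> V) (term_value (\<rho>(x := term_value \<rho> V)) T)"
  "term_value \<rho> (Cast U T) = combine 5 (term_value \<rho> U) (term_value \<rho> T)"
  by (transfer, simp)+

text \<open>Induction runs on a representative, so no freshness of bound variables is available, and
  none is assumed.\<close>

lemma term_induct [case_names Sort Var App Lam Def Cast]:
  fixes T :: "('s, 'v) term"
  assumes "\<And>s. P (Sort s)" "\<And>x. P (Var x)"
    "\<And>V T. P V \<Longrightarrow> P T \<Longrightarrow> P (App V T)"
    "\<And>x W T. P W \<Longrightarrow> P T \<Longrightarrow> P (Lam x W T)"
    "\<And>x V T. P V \<Longrightarrow> P T \<Longrightarrow> P (Def x V T)"
    "\<And>U T. P U \<Longrightarrow> P T \<Longrightarrow> P (Cast U T)"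
  shows "P T"
proof -
  have "P (abs_term t)" for t
    using assms
    by (induction t)
      (simp_all flip: Sort.abs_eq Var.abs_eq App.abs_eq Lam.abs_eq Def.abs_eq Cast.abs_eq)
  then show ?thesis
    by (rule term.abs_induct)
qed

section \<open>Agreement of values with arity assignment\<close>

primrec env_value :: "('s, 'v) env \<Rightarrow> 'v \<Rightarrow> nat" where
  "env_value Empty = (\<lambda>_. 0)"
| "env_value (EDecl K x W) = (env_value K)(x := term_value (env_value K) W)"
| "env_value (EDef K x V) = (env_value K)(x := term_value (env_value K) V)"

lemma term_value_if_has_arity:
  "has_arity L T A \<Longrightarrow> term_value (env_value L) T = Suc (arity_code A)"
  by (induction rule: has_arity.induct)
    (auto simp: fun_upd_def combine_Lam_eq combine_Def_eq combine_App_eq combine_Cast_eq)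

text \<open>A variable leads to a term stored in the environment, which is not a subterm. Isolating
  the variable case allows induction on terms first and on environments afterwards.\<close>

definition adequate :: "('s, 'v) env \<Rightarrow> bool" where
  "adequate L \<longleftrightarrow> (\<forall>x A. env_value L x = Suc (arity_code A) \<longrightarrow> has_arity L (Var x) A)"

lemma adequate_EDecl:
  assumes "adequate K"
    and "\<And>A. term_value (env_value K) W = Suc (arity_code A) \<Longrightarrow> has_arity K W A"
  shows "adequate (EDecl K x W)"
  using assms unfolding adequate_def by (auto intro: has_arity.intros)

lemma adequate_EDef:
  assumes "adequate K"
    and "\<And>A. term_value (env_value K) V = Suc (arity_code A) \<Longrightarrow> has_arity K V A"
  shows "adequate (EDef K x V)"
  using assms unfolding adequate_def by (auto intro: has_arity.intros)

text \<open>The derivation is built from the value by induction on the term. This avoids inverting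
  \<open>has_arity\<close>, which is delicate because \<open>Lam x W T\<close> determines neither
  \<open>x\<close> nor \<open>T\<close>.\<close>

lemma has_arity_if_term_value:
  "adequate L \<Longrightarrow> term_value (env_value L) T = Suc (arity_code A) \<Longrightarrow> has_arity L T A"
proof (induction T arbitrary: L A rule: term_induct)
  case (Sort s)
  then have "A = Base" by (cases A) auto
  then show ?case by (simp add: has_arity_Sort)
next
  case (Var x)
  then show ?case by (simp add: adequate_def)
next
  case (App V T)
  then obtain B where "term_value (env_value L) V = Suc (arity_code B)"
      "term_value (env_value L) T = Suc (arity_code (B \<Rrightarrow> A))"
    by (auto simp: combine_App_eq)
  then show ?case using App by (blast intro: has_arity_App)
next
  case (Lam x W T)
  then obtain B C where *: "term_value (env_value L) W = Suc (arity_code B)"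
      "term_value (env_value (EDecl L x W)) T = Suc (arity_code C)" "A = B \<Rrightarrow> C"
    by (auto simp: combine_Lam_eq simp del: arity_code.simps dest!: inj_arity_code)
  then have "has_arity L W B"
    using Lam by blast
  \<comment> \<open>The induction hypothesis for \<open>W\<close> is what makes the new entry
    adequate.\<close>
  moreover have "adequate (EDecl L x W)"
    using Lam by (intro adequate_EDecl) auto
  ultimately show ?case using Lam.IH(2) * by (metis has_arity_Lam)
next
  case (Def x V T)
  then obtain B where *: "term_value (env_value L) V = Suc (arity_code B)"
      "term_value (env_value (EDef L x V)) T = Suc (arity_code A)"
    by (auto simp: combine_Def_eq)
  moreover have "adequate (EDef L x V)"
    using Def by (intro adequate_EDef) auto
  moreover have "has_arity L V B"
    using Def * by blast
  ultimately show ?case using Def.IH(2) * by (metis has_arity_Def)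
next
  case (Cast U T)
  then show ?case by (auto simp: combine_Cast_eq intro: has_arity_Cast)
qed

lemma adequate: "adequate L"
proof (induction L)
  case Empty
  then show ?case by (simp add: adequate_def)
qed (auto intro: adequate_EDecl adequate_EDef has_arity_if_term_value)

lemma ex_has_arity_iff: "(\<exists>A. has_arity L T A) \<longleftrightarrow> term_value (env_value L) T \<noteq> 0"
  using term_value_if_has_arity has_arity_if_term_value[OF adequate] surj_arity_code
  by (metis not0_implies_Suc nat.simps(3))


section \<open>Evaluation of codes\<close>

definition code_Cons :: "nat \<Rightarrow> nat \<Rightarrow> nat" where
  "code_Cons a b = Suc (prod_encode (a, b))"

definition code_hd :: "nat \<Rightarrow> nat" where
  "code_hd n = fst (prod_decode (n - 1))"

definition code_tl :: "nat \<Rightarrow> nat" where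
  "code_tl n = snd (prod_decode (n - 1))"

definition item :: "nat \<Rightarrow> nat \<Rightarrow> nat" where
  "item i n = code_hd ((code_tl ^^ i) n)"

lemma computable_code_Cons [computable]:
  assumes "computable n f" "computable n g"
  shows "computable n (\<lambda>xs. code_Cons (f xs) (g xs))"
  unfolding code_Cons_def by (intro computable assms)

lemma computable_code_hd [computable]:
  assumes "computable n f"
  shows "computable n (\<lambda>xs. code_hd (f xs))"
  unfolding code_hd_def by (intro computable assms)

lemma computable_code_tl [computable]:
  assumes "computable n f"
  shows "computable n (\<lambda>xs. code_tl (f xs))"
  unfolding code_tl_def by (intro computable assms)

lemma computable_item [computable]:
  assumes "computable n f"
  shows "computable n (\<lambda>xs. item i (f xs))"
  unfolding item_def by (intro computable assms)

lemma code_hd_Cons [simp]: "code_hd (code_Cons a b) = a"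
  and code_tl_Cons [simp]: "code_tl (code_Cons a b) = b"
  and code_Cons_neq_0 [simp]: "code_Cons a b \<noteq> 0"
  by (simp_all add: code_hd_def code_tl_def code_Cons_def)

lemma code_hd_less: "0 < n \<Longrightarrow> code_hd n < n"
  and code_tl_less: "0 < n \<Longrightarrow> code_tl n < n"
  using le_prod_encode_1[of "code_hd n" "code_tl n"] le_prod_encode_2[of "code_tl n" "code_hd n"]
  by (auto simp: code_hd_def code_tl_def)

lemma code_hd_0 [simp]: "code_hd 0 = 0"
  and code_tl_0 [simp]: "code_tl 0 = 0"
  by (simp_all add: code_hd_def code_tl_def prod_decode_def prod_decode_aux.simps)

lemma list_encode_Cons: "list_encode (a # as) = code_Cons a (list_encode as)"
  by (simp add: code_Cons_def)

declare list_encode.simps(2) [simp del]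

lemma code_hd_list_encode [simp]: "code_hd (list_encode (a # as)) = a"
  by (simp add: list_encode_Cons)

lemma item_0 [simp]: "item 0 n = code_hd n"
  and item_Suc_Cons [simp]: "item (Suc i) (code_Cons a b) = item i b"
  by (simp_all add: item_def funpow_swap1)

lemma item_list_encode [simp]: "i < length as \<Longrightarrow> item i (list_encode as) = as ! i"
proof (induction as arbitrary: i)
  case (Cons a as)
  then show ?case by (cases i) (simp_all add: list_encode_Cons)
qed simp

text \<open>Tails do not increase a number and the head of a positive number is smaller. A nonzero
  tag forces positivity, so recursion into any item of a tagged number is well-founded.\<close>

lemma item_less:
  assumes "0 < code_hd n"
  shows "item i n < n"
proof -
  have n: "0 < n"
    using assms by (cases n) auto
  have le: "code_tl m \<le> m" for m
    using code_tl_less[of m] by (cases m) auto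
  have "(code_tl ^^ i) n \<le> n"
    by (induction i) (auto intro: le_trans[OF le])
  then show ?thesis
    using n code_hd_less[of "(code_tl ^^ i) n"]
    by (cases "(code_tl ^^ i) n = 0") (auto simp: item_def)
qed

text \<open>Every number is the code of some tree, so evaluation can be a total function on numbers.
  Adding the tag to the weight makes the total weight decrease when the bound variable and its
  entry move from a term (tag 3 or 4) to the environment (tag 1).\<close>

function weight :: "nat \<Rightarrow> nat" where
  "weight n = (if code_hd n = 0 then 0
     else code_hd n + weight (item 1 n) + weight (item 2 n) + weight (item 3 n))"
  by auto
termination
  by (relation "measure id") (auto intro: item_less)

declare weight.simps [simp del]

lemma weight_eq:
  "code_hd n \<noteq> 0 \<Longrightarrow>
    weight n = code_hd n + weight (item 1 n) + weight (item 2 n) + weight (item 3 n)"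
  by (subst weight.simps) simp

text \<open>Since a definition and a declaration in the environment have the same effect on arities,
  a local definition also extends the environment by an entry with tag 1.\<close>

function code_value :: "nat \<Rightarrow> nat \<Rightarrow> nat" where
  "code_value L t =
    (if code_hd t = 0 then 1
     else if code_hd t = 1 then
       (if code_hd L = 0 then 0
        else code_value (item 1 L) (if item 2 L = item 1 t then item 3 L else t))
     else if code_hd t = 3 \<or> code_hd t = 4 then
       combine (code_hd t) (code_value L (item 2 t))
         (code_value (list_encode [1, L, item 1 t, item 2 t]) (item 3 t))
     else combine (code_hd t) (code_value L (item 1 t)) (code_value L (item 2 t)))"
  by auto
termination
proof (relation "measure (\<lambda>(L, t). weight L + weight t)", goal_cases)
  \<comment> \<open>Dropping the last entry saves its positive tag, whether the search goes on with
    \<open>t\<close> or moves to the stored \<open>item 3 L\<close>, which was already counted in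
    \<open>weight L\<close>.\<close>
  case (2 L t)
  then show ?case using weight_eq[of L] by simp
next
  case (3 L t)
  then show ?case using weight_eq[of t] by simp
next
  case (4 L t)
  then show ?case using weight_eq[of t] weight_eq[of "list_encode [1, L, item 1 t, item 2 t]"]
    by auto
next
  case (5 L t)
  then show ?case using weight_eq[of t] by simp
next
  case (6 L t)
  then show ?case using weight_eq[of t] by simp
qed simp

declare code_value.simps [simp del]

section \<open>Correctness of evaluation on codes\<close>

lemma code_value_Var:
  assumes "k \<noteq> 0"
  shows "code_value (list_encode [k, L, a, V]) (list_encode [1, b]) =
    (if a = b then code_value L V else code_value L (list_encode [1, b]))"
  using assms by (subst code_value.simps) simp

text \<open>Extending the coded environment acts as the function update in
  \<open>preterm_value\<close> and \<open>env_value\<close>. Injectivity of \<open>cv\<close> makes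
  comparing codes the same as comparing variables.\<close>

lemma code_value_Var_fun_upd:
  assumes "inj cv" "k \<noteq> 0"
  shows "(\<lambda>y. code_value (list_encode [k, L, cv x, V]) (list_encode [1, cv y])) =
    (\<lambda>y. code_value L (list_encode [1, cv y]))(x := code_value L V)"
proof
  fix y
  show "code_value (list_encode [k, L, cv x, V]) (list_encode [1, cv y]) =
      ((\<lambda>y. code_value L (list_encode [1, cv y]))(x := code_value L V)) y"
    unfolding code_value_Var[OF assms(2)] using assms(1) by (simp add: inj_eq)
qed

text \<open>\<open>L\<close> is any number and matters only through the values it gives to
  variables. The induction can thus pass under binders, where \<open>L\<close> grows.\<close>

lemma code_value_preterm_code:
  fixes cs :: "'s \<Rightarrow> nat" and cv :: "'v \<Rightarrow> nat"
  assumes "inj cv"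
  shows "code_value L (preterm_code cs cv t) =
    preterm_value (\<lambda>x. code_value L (list_encode [1, cv x])) t"
proof (induction t arbitrary: L)
  case (PSort s)
  show ?case by (simp add: code_value.simps)
next
  case (PVar x)
  show ?case by simp
next
  case (PApp V T)
  then show ?case by (simp add: code_value.simps[of L "list_encode (2 # _)"])
next
  case (PLam x W T)
  have "code_value L (preterm_code cs cv (PLam x W T)) =
      combine 3 (code_value L (preterm_code cs cv W))
        (code_value (list_encode [1, L, cv x, preterm_code cs cv W]) (preterm_code cs cv T))"
    by (subst code_value.simps) simp
  then show ?case by (simp only: PLam.IH code_value_Var_fun_upd[OF assms one_neq_zero]
        preterm_value.simps)
next
  case (PDef x V T)
  have "code_value L (preterm_code cs cv (PDef x V T)) =
      combine 4 (code_value L (preterm_code cs cv V))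
        (code_value (list_encode [1, L, cv x, preterm_code cs cv V]) (preterm_code cs cv T))"
    by (subst code_value.simps) simp
  then show ?case by (simp only: PDef.IH code_value_Var_fun_upd[OF assms one_neq_zero]
        preterm_value.simps)
next
  case (PCast U T)
  then show ?case by (simp add: code_value.simps[of L "list_encode (5 # _)"])
qed

lemma code_value_codes_term:
  assumes "inj cv" "codes_term cs cv n T"
  shows "code_value m n = term_value (\<lambda>x. code_value m (list_encode [1, cv x])) T"
  using assms by (auto simp: codes_term_def code_value_preterm_code term_value.abs_eq)

lemma code_value_codes_env:
  assumes "inj cv" "codes_env cs cv m L"
  shows "(\<lambda>x. code_value m (list_encode [1, cv x])) = env_value L"
  using assms(2)
proof induction
  case codes_Empty
  show ?case by (simp add: code_value.simps)
next
  case (codes_EDecl m K n W x)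
  then show ?case
    by (simp only: code_value_Var_fun_upd[OF assms(1) one_neq_zero]
        code_value_codes_term[OF assms(1) codes_EDecl.hyps(2)] env_value.simps)
next
  case (codes_EDef m K n V x)
  then show ?case
    by (simp only: code_value_Var_fun_upd[OF assms(1) zero_neq_numeral[symmetric]]
        code_value_codes_term[OF assms(1) codes_EDef.hyps(2)] env_value.simps)
qed


section \<open>A stack machine\<close>

text \<open>A state consists of a stack of tasks and a stack of values.  The task \<open>[0, L, t]\<close> pushes the
  value of \<open>t\<close> in \<open>L\<close>, and the task \<open>[k]\<close> with \<open>k \<noteq> 0\<close> applies \<open>combine k\<close>
  to the two topmost values.\<close>

definition step :: "nat \<Rightarrow> nat" where
  "step s =
    (let c = item 0 s; v = item 1 s; task = code_hd c; rest = code_tl c;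
         k = code_hd task; L = item 1 task; t = item 2 task
     in if c = 0 then s
        else if k \<noteq> 0 then
          list_encode [rest, code_Cons (combine k (item 1 v) (code_hd v)) (code_tl (code_tl v))]
        else if code_hd t = 0 then list_encode [rest, code_Cons 1 v]
        else if code_hd t = 1 then
          (if code_hd L = 0 then list_encode [rest, code_Cons 0 v]
           else list_encode [code_Cons
             (list_encode [0, item 1 L, if item 2 L = item 1 t then item 3 L else t]) rest, v])
        else if code_hd t = 3 \<or> code_hd t = 4 then
          list_encode [code_Cons (list_encode [0, L, item 2 t])
            (code_Cons (list_encode [0, list_encode [1, L, item 1 t, item 2 t], item 3 t])
              (code_Cons (list_encode [code_hd t]) rest)), v]
        else
          list_encode [code_Cons (list_encode [0, L, item 1 t])
            (code_Cons (list_encode [0, L, item 2 t])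
              (code_Cons (list_encode [code_hd t]) rest)), v])"

lemma computable_step [computable]: "computable 1 (\<lambda>xs. step (xs ! 0))"
  unfolding step_def Let_def list_encode_Cons list_encode.simps(1) by (intro computable)

lemma step_eval:
  "step (list_encode [code_Cons (list_encode [0, L, t]) c, v]) =
    (if code_hd t = 0 then list_encode [c, code_Cons 1 v]
     else if code_hd t = 1 then
       (if code_hd L = 0 then list_encode [c, code_Cons 0 v]
        else list_encode [code_Cons
          (list_encode [0, item 1 L, if item 2 L = item 1 t then item 3 L else t]) c, v])
     else if code_hd t = 3 \<or> code_hd t = 4 then
       list_encode [code_Cons (list_encode [0, L, item 2 t])
         (code_Cons (list_encode [0, list_encode [1, L, item 1 t, item 2 t], item 3 t])
           (code_Cons (list_encode [code_hd t]) c)), v]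
     else
       list_encode [code_Cons (list_encode [0, L, item 1 t])
         (code_Cons (list_encode [0, L, item 2 t])
           (code_Cons (list_encode [code_hd t]) c)), v])"
  by (simp add: step_def Let_def)

text \<open>The operand evaluated first lies below the other on the value stack, hence the exchanged
  order of \<open>a\<close> and \<open>b\<close>.\<close>

lemma step_combine:
  "k \<noteq> 0 \<Longrightarrow>
    step (list_encode [code_Cons (list_encode [k]) c, code_Cons a (code_Cons b v)]) =
    list_encode [c, code_Cons (combine k b a) v]"
  by (simp add: step_def Let_def)

lemma step_halted: "item 0 s = 0 \<Longrightarrow> step s = s"
  by (simp add: step_def)

section \<open>Correctness of the machine\<close>

definition reaches :: "nat \<Rightarrow> nat \<Rightarrow> bool" where
  "reaches s s' \<longleftrightarrow> (\<exists>k. (step ^^ k) s = s')"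

lemma reaches_step: "reaches s (step s)"
  unfolding reaches_def by (rule exI[of _ 1]) simp

lemma reaches_trans: "reaches s s' \<Longrightarrow> reaches s' s'' \<Longrightarrow> reaches s s''"
  unfolding reaches_def by (metis comp_apply funpow_add)

text \<open>The subtasks run one after the other above an untouched rest. As their runs are assumed
  for all stacks, the second may start above the value left by the first.\<close>

lemma reaches_combine:
  assumes "k \<noteq> 0"
    and "\<And>c v. reaches (list_encode [code_Cons (list_encode [0, L1, t1]) c, v])
           (list_encode [c, code_Cons b v])"
    and "\<And>c v. reaches (list_encode [code_Cons (list_encode [0, L2, t2]) c, v])
           (list_encode [c, code_Cons a v])"
  shows "reaches
    (list_encode [code_Cons (list_encode [0, L1, t1]) (code_Cons (list_encode [0, L2, t2])
      (code_Cons (list_encode [k]) c)), v])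
    (list_encode [c, code_Cons (combine k b a) v])"
  unfolding step_combine[OF assms(1), symmetric]
  by (rule reaches_trans[OF assms(2) reaches_trans[OF assms(3) reaches_step]])

lemma reaches_code_value:
  "reaches (list_encode [code_Cons (list_encode [0, L, t]) c, v])
     (list_encode [c, code_Cons (code_value L t) v])"
proof (induction L t arbitrary: c v rule: code_value.induct)
  case (1 L t)
  let ?s = "list_encode [code_Cons (list_encode [0, L, t]) c, v]"
  \<comment> \<open>These are the cases whose first step leaves subtasks to run. In the others,
    treated at the end, the first step pushes the value itself.\<close>
  have "reaches (step ?s) (list_encode [c, code_Cons (code_value L t) v])"
    if tags: "code_hd t \<noteq> 0" "code_hd t = 1 \<Longrightarrow> code_hd L \<noteq> 0"
  proof -
    consider (Var) "code_hd t = 1" "code_hd L \<noteq> 0"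
      | (abstr) "code_hd t \<noteq> 1" "code_hd t = 3 \<or> code_hd t = 4"
      | (other) "code_hd t \<noteq> 1" "\<not> (code_hd t = 3 \<or> code_hd t = 4)"
      using tags by blast
    then show ?thesis
    proof cases
      case Var
      have "step ?s = list_encode [code_Cons
          (list_encode [0, item 1 L, if item 2 L = item 1 t then item 3 L else t]) c, v]"
        unfolding step_eval using Var tags by simp
      moreover have "code_value L t =
          code_value (item 1 L) (if item 2 L = item 1 t then item 3 L else t)"
        using Var tags by (subst code_value.simps) simp
      ultimately show ?thesis
        using "1.IH"(1) Var tags by metis
    next
      case abstr
      have "code_value L t = combine (code_hd t) (code_value L (item 2 t))
          (code_value (list_encode [1, L, item 1 t, item 2 t]) (item 3 t))"
        using abstr tags by (subst code_value.simps) simp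
      moreover have "step ?s = list_encode [code_Cons (list_encode [0, L, item 2 t])
          (code_Cons (list_encode [0, list_encode [1, L, item 1 t, item 2 t], item 3 t])
            (code_Cons (list_encode [code_hd t]) c)), v]"
        unfolding step_eval using abstr tags by simp
      ultimately show ?thesis
        using reaches_combine[OF tags(1) "1.IH"(2,3)] abstr tags by simp
    next
      case other
      have "code_value L t =
          combine (code_hd t) (code_value L (item 1 t)) (code_value L (item 2 t))"
        using other tags by (subst code_value.simps) simp
      moreover have "step ?s = list_encode [code_Cons (list_encode [0, L, item 1 t])
          (code_Cons (list_encode [0, L, item 2 t]) (code_Cons (list_encode [code_hd t]) c)), v]"
        unfolding step_eval using other tags by simp
      ultimately show ?thesis
        using reaches_combine[OF tags(1) "1.IH"(4,5)] other tags by simp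
    qed
  qed
  moreover have "step ?s = list_encode [c, code_Cons (code_value L t) v]"
    if "code_hd t = 0 \<or> code_hd t = 1 \<and> code_hd L = 0"
    using that by (subst code_value.simps) (auto simp: step_eval)
  ultimately show ?case
    using reaches_step reaches_trans by metis
qed

definition start :: "nat \<Rightarrow> nat \<Rightarrow> nat" where
  "start m n = list_encode [code_Cons (list_encode [0, m, n]) 0, 0]"

definition halting_time :: "nat \<Rightarrow> nat \<Rightarrow> nat" where
  "halting_time m n = (LEAST k. item 0 ((step ^^ k) (start m n)) = 0)"

text \<open>The run from empty surrounding stacks, both coded by 0, ends with no task left.\<close>

lemma halts: "\<exists>k. item 0 ((step ^^ k) (start m n)) = 0"
  using reaches_code_value[of m n 0 0] unfolding reaches_def start_def
  by (metis code_hd_list_encode item_0)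

lemma funpow_step_halted: "item 0 s = 0 \<Longrightarrow> (step ^^ k) s = s"
  by (induction k) (simp_all add: step_halted)

lemma funpow_halting_time:
  "(step ^^ halting_time m n) (start m n) = list_encode [0, code_Cons (code_value m n) 0]"
proof -
  obtain k where k: "(step ^^ k) (start m n) = list_encode [0, code_Cons (code_value m n) 0]"
    using reaches_code_value[of m n 0 0] by (auto simp: reaches_def start_def)
  let ?h = "halting_time m n"
  let ?s = "(step ^^ ?h) (start m n)"
  \<comment> \<open>The machine may halt before the known time \<open>k\<close>, but a halted state
    is a fixed point, so the states at both times coincide.\<close>
  have "?h \<le> k"
    unfolding halting_time_def by (rule Least_le) (simp add: k)
  then have "(step ^^ k) (start m n) = (step ^^ (k - ?h)) ?s"
    by (metis comp_apply funpow_add le_add_diff_inverse2)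
  also have "item 0 ?s = 0"
    unfolding halting_time_def using halts by (rule LeastI_ex)
  then have "(step ^^ (k - ?h)) ?s = ?s"
    by (rule funpow_step_halted)
  finally show ?thesis using k by simp
qed

lemma computable_code_value: "computable 2 (\<lambda>xs. code_value (xs ! 0) (xs ! 1))"
proof -
  have start: "computable n (\<lambda>xs. start (f xs) (g xs))"
    if "computable n f" "computable n g" for n f g
    unfolding start_def list_encode_Cons list_encode.simps(1) by (intro computable that)
  have "computable (Suc 2) (\<lambda>xs. item 0 ((step ^^ (xs ! 0)) (start (xs ! 1) (xs ! 2))))"
    by (intro computable start computable_proj) simp_all
  then have "computable (Suc 2)
      (\<lambda>xs. item 0 ((step ^^ hd xs) (start (tl xs ! 0) (tl xs ! 1))))"
    by (rule computable_cong) (auto simp: length_Suc_conv numeral_2_eq_2)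
  then have "computable 2 (\<lambda>xs. halting_time (xs ! 0) (xs ! 1))"
    unfolding halting_time_def using halts by (rule computable_Least)
  \<comment> \<open>In the halted state, item 1 is the value stack, and its top is the
    result.\<close>
  then have "computable 2 (\<lambda>xs. item 0 (item 1
      ((step ^^ halting_time (xs ! 0) (xs ! 1)) (start (xs ! 0) (xs ! 1)))))"
    by (intro computable start computable_proj) simp_all
  then show ?thesis
    by (simp add: funpow_halting_time)
qed

theorem theorem4p3:
  fixes cs :: "'s \<Rightarrow> nat" and cv :: "'v \<Rightarrow> nat"
  assumes "infinite (UNIV :: 'v set)" and "inj cv"
  shows "decidable2 (codes_env cs cv) (codes_term cs cv)
           (\<lambda>(L :: ('s, 'v) env) (T :: ('s, 'v) term). \<exists>A. has_arity L T A)"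
proof -
  have "computable 2 (\<lambda>xs. if code_value (xs ! 0) (xs ! 1) = 0 then 0 else 1)"
    by (intro computable computable_code_value)
  then obtain f where f: "recursive 2 f"
      "\<And>xs. length xs = 2 \<Longrightarrow> (if code_value (xs ! 0) (xs ! 1) = 0 then 0 else 1) = f xs"
    unfolding computable_def by blast
  \<comment> \<open>The codes may come from any representatives: \<open>m\<close> induces
    \<open>env_value L\<close>, and under it \<open>n\<close> evaluates to the value of
    \<open>T\<close>, which is nonzero exactly when an arity exists.\<close>
  have "f [m, n] = (if \<exists>A. has_arity L T A then 1 else 0)"
    if "codes_env cs cv m L" "codes_term cs cv n T" for L T m n
    using f(2)[of "[m, n]"] code_value_codes_term[OF assms(2) that(2), of m]
    by (simp add: ex_has_arity_iff code_value_codes_env[OF assms(2) that(1), simplified]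
        split: if_splits)
  then show ?thesis
    unfolding decidable2_def using f(1) by blast
qed

end
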